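(* Let $m=2\ell+1$ with $\ell\ge 0$, and let $\mathfrak{I}^{(m)}$ be the set of all involutions having no descending subsequence of length $m+1$. Write $\bar x_j=1/x_j$. Then the ordinary generating function of these involutions is $$\sum_{\tau\in\mathfrak{I}^{(m)}}t^{|\tau|}=\left[x_1x_2^2\cdots x_\ell^\ell\right]\ \frac{\det\left(x_j^i-\bar x_j^i\right)_{1\le i,j\le\ell}}{1-t(1+x_1+\cdots+x_\ell+\bar x_1+\cdots+\bar x_\ell)}.$$ Equivalently, their exponential generating function is $$\sum_{\tau\in\mathfrak{I}^{(m)}}\frac{t^{|\tau|}}{|\tau|!}=e^t\,\left[x_1x_2^2\cdots x_\ell^\ell\right]\ \det\left((x_j^i-\bar x_j^i)\,e^{t(x_j+\bar x_j)}\right)_{1\le i,j\le\ell}.$$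
   Context: An involution of length $n$ is a permutation $\tau$ of $\{1,\dots,n\}$ with $\tau\circ\tau=\mathrm{id}$; $|\tau|=n$, and the empty permutation (length $0$) is included. A descending subsequence of length $k$ is a $k$-tuple $(\tau(i_1),\dots,\tau(i_k))$ with $i_1<\cdots<i_k$ and $\tau(i_1)>\cdots>\tau(i_k)$. The expressions on the right are regarded as formal power series in $t$ with coefficients in the Laurent polynomial ring $\mathbb{Q}[x_1,\bar x_1,\dots,x_\ell,\bar x_\ell]$, and $[x_1x_2^2\cdots x_\ell^\ell]$ denotes extraction (coefficientwise in $t$) of the coefficient of the monomial $x_1^1x_2^2\cdots x_\ell^\ell$. An empty determinant equals $1$. *)

theory Defs
  imports
    "Jordan_Normal_Form.Determinant"
    "HOL-Library.Poly_Mapping"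
    "HOL-Analysis.Infinite_Sum"
    "HOL-Computational_Algebra.Formal_Power_Series"
begin

section \<open>Involutions without long descending subsequences\<close>

definition has_descending_subseq :: "nat \<Rightarrow> (nat \<Rightarrow> nat) \<Rightarrow> nat \<Rightarrow> bool" where
  "has_descending_subseq n \<tau> k \<longleftrightarrow>
     (\<exists>is. length is = k \<and> set is \<subseteq> {1..n} \<and> sorted_wrt (<) is \<and> sorted_wrt (>) (map \<tau> is))"

text \<open>
  A function that permutes \<open>{1..n}\<close> is the identity outside \<open>{1..n}\<close> and so does not
  determine \<open>n\<close>; an involution of length \<open>n\<close> is therefore recorded as a pair \<open>(n, \<tau>)\<close>, whose
  length is its first component.
\<close>

definition involutions_avoiding :: "nat \<Rightarrow> (nat \<times> (nat \<Rightarrow> nat)) set" where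
  "involutions_avoiding m =
     {(n, \<tau>). \<tau> permutes {1..n} \<and> \<tau> \<circ> \<tau> = id \<and> \<not> has_descending_subseq n \<tau> (m + 1)}"

section \<open>Generating functions\<close>

definition ordinary_gf :: "('a \<Rightarrow> nat) \<Rightarrow> 'a set \<Rightarrow> rat fps" where
  "ordinary_gf sz A = Abs_fps (\<lambda>n. of_nat (card {a \<in> A. sz a = n}))"

definition exponential_gf :: "('a \<Rightarrow> nat) \<Rightarrow> 'a set \<Rightarrow> rat fps" where
  "exponential_gf sz A = Abs_fps (\<lambda>n. of_nat (card {a \<in> A. sz a = n}) / fact n)"

text \<open>
  As long as there are finitely many objects of each size, these are the sums of
  \<open>t ^ sz a\<close> and of \<open>t ^ sz a / fact (sz a)\<close> over all \<open>a \<in> A\<close>, where \<open>t\<close> is \<open>fps_X\<close>.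
\<close>

lemma weighted_gf_has_sum:
  fixes w :: "nat \<Rightarrow> rat"
  assumes fin: "\<And>n. finite {a \<in> A. sz a = n}"
  shows "((\<lambda>a. fps_const (w (sz a)) * fps_X ^ sz a) has_sum
           Abs_fps (\<lambda>n. w n * of_nat (card {a \<in> A. sz a = n}))) A"
  unfolding has_sum_def
proof (rule tendsto_fpsI)
  fix n
  let ?B = "{a \<in> A. sz a = n}"
  have "fps_nth (\<Sum>a\<in>F. fps_const (w (sz a)) * fps_X ^ sz a) n = w n * of_nat (card ?B)"
    if F: "finite F" "?B \<subseteq> F" "F \<subseteq> A" for F
  proof -
    have "fps_nth (\<Sum>a\<in>F. fps_const (w (sz a)) * fps_X ^ sz a) n
          = (\<Sum>a\<in>F. if sz a = n then w n else 0)"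
      unfolding fps_sum_nth by (intro sum.cong) auto
    also have "\<dots> = (\<Sum>a\<in>?B. w n)"
      using F by (intro sum.mono_neutral_cong_right) auto
    finally show ?thesis by simp
  qed
  then show "\<forall>\<^sub>F F in finite_subsets_at_top A.
      fps_nth (\<Sum>a\<in>F. fps_const (w (sz a)) * fps_X ^ sz a) n =
      fps_nth (Abs_fps (\<lambda>n. w n * of_nat (card {a \<in> A. sz a = n}))) n"
    unfolding eventually_finite_subsets_at_top using fin by (intro exI[of _ ?B]) auto
qed

lemma ordinary_gf_has_sum:
  assumes "\<And>n. finite {a \<in> A. sz a = n}"
  shows "((\<lambda>a. fps_X ^ sz a) has_sum ordinary_gf sz A) A"
  using weighted_gf_has_sum[OF assms, of "\<lambda>_. 1"] by (simp add: ordinary_gf_def)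

lemma exponential_gf_has_sum:
  assumes "\<And>n. finite {a \<in> A. sz a = n}"
  shows "((\<lambda>a. fps_const (1 / fact (sz a)) * fps_X ^ sz a) has_sum exponential_gf sz A) A"
  using weighted_gf_has_sum[OF assms, of "\<lambda>n. 1 / fact n"] by (simp add: exponential_gf_def)

lemma finite_involutions_avoiding: "finite {p \<in> involutions_avoiding m. fst p = n}"
proof (rule finite_subset)
  show "{p \<in> involutions_avoiding m. fst p = n} \<subseteq> Pair n ` {\<tau>. \<tau> permutes {1..n}}"
    by (auto simp: involutions_avoiding_def)
qed (simp add: finite_permutations)

section \<open>Laurent polynomials and power series over them\<close>

text \<open>
  Laurent polynomials are finitely supported functions from exponent vectors to coefficients.
  The variables are indexed by all of \<open>nat\<close>, so that this one ring contains the Laurent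
  polynomial ring in \<open>x\<^sub>1, \<dots>, x\<^sub>\<ell>\<close> for every \<open>\<ell>\<close>.
\<close>

type_synonym laurent = "(nat \<Rightarrow>\<^sub>0 int) \<Rightarrow>\<^sub>0 rat"

definition lconst :: "rat \<Rightarrow> laurent" where
  "lconst c = Poly_Mapping.single 0 c"

definition lvar :: "nat \<Rightarrow> laurent" where
  "lvar j = Poly_Mapping.single (Poly_Mapping.single j 1) 1"

definition lvar_inv :: "nat \<Rightarrow> laurent" where
  "lvar_inv j = Poly_Mapping.single (Poly_Mapping.single j (- 1)) 1"

lemma lvar_mult_lvar_inv: "lvar j * lvar_inv j = 1"
  by (simp add: lvar_def lvar_inv_def mult_single flip: single_add)

text \<open>The exponent vector of the monomial \<open>x\<^sub>1\<^sup>1 x\<^sub>2\<^sup>2 \<dots> x\<^sub>\<ell>\<^sup>\<ell>\<close>.\<close>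

definition staircase_exponent :: "nat \<Rightarrow> (nat \<Rightarrow>\<^sub>0 int)" where
  "staircase_exponent l = (\<Sum>j = 1..l. Poly_Mapping.single j (int j))"

definition extract_coeff :: "(nat \<Rightarrow>\<^sub>0 int) \<Rightarrow> laurent fps \<Rightarrow> rat fps" where
  "extract_coeff e f = Abs_fps (\<lambda>n. Poly_Mapping.lookup (fps_nth f n) e)"

text \<open>
  \<open>1 / (1 - t a)\<close> and \<open>exp (t a)\<close> for a Laurent polynomial \<open>a\<close>. The division of \<open>fps\<close> and
  \<open>fps_exp\<close> are not available here, as Laurent polynomials do not form a field.
\<close>

definition fps_geometric :: "laurent \<Rightarrow> laurent fps" where
  "fps_geometric a = fps_right_inverse (1 - fps_X * fps_const a) 1"

definition fps_exp_laurent :: "laurent \<Rightarrow> laurent fps" where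
  "fps_exp_laurent a = Abs_fps (\<lambda>n. lconst (1 / fact n) * a ^ n)"

lemma fps_geometric_inverse: "(1 - fps_X * fps_const a) * fps_geometric a = 1"
  unfolding fps_geometric_def by (rule fps_right_inverse) simp

text \<open>Matrices are indexed from \<open>0\<close>, hence the shift of both indices by one.\<close>

definition ordinary_matrix :: "nat \<Rightarrow> laurent mat" where
  "ordinary_matrix l =
     mat l l (\<lambda>(i, j). lvar (j + 1) ^ (i + 1) - lvar_inv (j + 1) ^ (i + 1))"

definition exponential_matrix :: "nat \<Rightarrow> laurent fps mat" where
  "exponential_matrix l =
     mat l l (\<lambda>(i, j). fps_const (lvar (j + 1) ^ (i + 1) - lvar_inv (j + 1) ^ (i + 1))
                       * fps_exp_laurent (lvar (j + 1) + lvar_inv (j + 1)))"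

end

theory Submission
  imports Defs
begin

text \<open>
  Fixed points do not affect nestings, and an involution has a descending subsequence of length
  \<open>2 l + 2\<close> iff it has \<open>l + 1\<close> nested 2-cycles. Read an involution from left to right and give every
  open cycle as rank the length of the longest nest inside it, so that a cycle of rank \<open>\<rho>\<close> may be
  closed only if \<open>\<rho> < l\<close>, and closing it moves the open cycles of rank \<open>\<rho>\<close> on its left to rank
  \<open>\<rho> + 1\<close>. Weight an open cycle of rank \<open>\<rho>\<close> by \<open>y\<^sub>\<rho> = 1/x\<^sub>\<rho>\<^sub>+\<^sub>1 + \<dots> + 1/x\<^sub>\<ell>\<close>. By a telescoping sum, the
  weights \<open>Q'\<close> of the states that arise from a state of weight \<open>Q\<close> by closing a cycle of rank \<open>\<rho>\<close>
  add up to \<open>x\<^sub>\<rho>\<^sub>+\<^sub>1 (Q - Q[y\<^sub>\<rho> := y\<^sub>\<rho>\<^sub>+\<^sub>1])\<close>. Hence one step of reading multiplies \<open>Q\<close> by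
  \<open>1 + \<Sum>x\<^sub>j + \<Sum>1/x\<^sub>j\<close> up to the terms \<open>x\<^sub>\<rho>\<^sub>+\<^sub>1 Q[y\<^sub>\<rho> := y\<^sub>\<rho>\<^sub>+\<^sub>1]\<close>, and these contribute nothing to the
  coefficient of \<open>x\<^sub>1 x\<^sub>2\<^sup>2 \<dots> x\<^sub>\<ell>\<^sup>\<ell>\<close> after multiplication with the determinant, which is
  antisymmetric under the hyperoctahedral group. So this coefficient counts the completions of a
  state, and the initial state has weight \<open>1\<close>.
\<close>

section \<open>Reflections of Laurent polynomials\<close>

lemma det_scale_cols:
  fixes c :: "nat \<Rightarrow> 'a :: comm_ring_1"
  shows "det (mat n n (\<lambda>(i, j). c j * f i j)) = (\<Prod>j<n. c j) * det (mat n n (\<lambda>(i, j). f i j))"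
proof -
  have "det (mat n n (\<lambda>(i, j). g i j)) = (\<Sum>p | p permutes {0..<n}. signof p * (\<Prod>j<n. g (p j) j))"
    for g :: "nat \<Rightarrow> nat \<Rightarrow> 'a"
    by (subst det_col[of _ n]) (auto intro!: sum.cong prod.cong arg_cong2[of _ _ _ _ "(*)"] dest: permutes_in_image)
  then show ?thesis
    by (simp add: prod.distrib sum_distrib_left mult.left_commute)
qed

lemma poly_mapping_sum_single:
  "f = (\<Sum>k\<in>Poly_Mapping.keys f. Poly_Mapping.single k (Poly_Mapping.lookup f k))"
  by (rule poly_mapping_eqI)
     (auto simp: lookup_sum lookup_single when_def in_keys_iff if_distrib sum.delta cong: if_cong)

lemma lookup_single_mult:
  fixes f :: "'a::ab_group_add \<Rightarrow>\<^sub>0 'b::comm_semiring_1"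
  shows "Poly_Mapping.lookup (Poly_Mapping.single k v * f) e = v * Poly_Mapping.lookup f (e - k)"
proof -
  have "Poly_Mapping.single k v * f
      = (\<Sum>q\<in>Poly_Mapping.keys f. Poly_Mapping.single (k + q) (v * Poly_Mapping.lookup f q))"
    by (subst poly_mapping_sum_single[of f]) (simp add: sum_distrib_left mult_single)
  moreover have "(k + q = e) = (q = e - k)" for q
    by (auto simp: algebra_simps)
  ultimately show ?thesis
    by (simp add: lookup_sum lookup_single when_def if_distrib sum.delta in_keys_iff cong: if_cong)
qed

lemma lookup_sign_mult:
  fixes f :: "'a::ab_group_add \<Rightarrow>\<^sub>0 'b::comm_ring_1"
  shows "Poly_Mapping.lookup ((- 1) ^ n * f) e = (- 1) ^ n * Poly_Mapping.lookup f e"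
  by (simp add: minus_one_power_iff)

lemma lookup_signof_mult:
  fixes f :: "'a::ab_group_add \<Rightarrow>\<^sub>0 'b::comm_ring_1"
  shows "Poly_Mapping.lookup (signof p * f) e = signof p * Poly_Mapping.lookup f e"
  by (simp add: sign_def)

locale exponent_involution =
  fixes \<phi> :: "(nat \<Rightarrow>\<^sub>0 int) \<Rightarrow> (nat \<Rightarrow>\<^sub>0 int)"
  assumes add: "\<phi> (a + b) = \<phi> a + \<phi> b"
    and involutive: "\<phi> (\<phi> a) = a"
begin

definition act :: "laurent \<Rightarrow> laurent" where
  "act = Poly_Mapping.map_key \<phi>"

lemma inj: "inj \<phi>"
  by (metis involutive injI)

lemma zero: "\<phi> 0 = 0"
  using add[of 0 0] by simp

lemma diff: "\<phi> (a - b) = \<phi> a - \<phi> b"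
  using add[of "a - b" b] by (simp add: algebra_simps)

lemma lookup_act: "Poly_Mapping.lookup (act f) e = Poly_Mapping.lookup f (\<phi> e)"
  by (simp add: act_def map_key.rep_eq[OF inj])

lemma act_single: "act (Poly_Mapping.single k v) = Poly_Mapping.single (\<phi> k) v"
  using map_key_single[OF inj, of "\<phi> k"] by (simp add: act_def involutive)

lemma act_add: "act (f + g) = act f + act g"
  by (simp add: act_def map_key_plus[OF inj])

lemma act_single_mult: "act (Poly_Mapping.single k v * g) = act (Poly_Mapping.single k v) * act g"
  by (rule poly_mapping_eqI) (simp add: act_single lookup_act lookup_single_mult diff involutive)

lemma act_0: "act 0 = 0"
  by (rule poly_mapping_eqI) (simp add: lookup_act)

lemma act_sum: "act (\<Sum>i\<in>I. f i) = (\<Sum>i\<in>I. act (f i))"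
  by (induction I rule: infinite_finite_induct) (simp_all add: act_0 act_add)

lemma act_mult: "act (f * g) = act f * act g"
proof -
  let ?s = "\<lambda>k. Poly_Mapping.single k (Poly_Mapping.lookup f k)"
  have "act (f * g) = act ((\<Sum>k\<in>Poly_Mapping.keys f. ?s k) * g)"
    by (simp flip: poly_mapping_sum_single)
  also have "\<dots> = act (\<Sum>k\<in>Poly_Mapping.keys f. ?s k) * act g"
    by (simp add: sum_distrib_right act_sum act_single_mult)
  finally show ?thesis
    by (simp flip: poly_mapping_sum_single)
qed

lemma act_1: "act 1 = 1"
  using act_single[of 0 1] by (simp add: zero)

sublocale comm_ring_hom act
  by unfold_locales (simp_all add: act_0 act_1 act_add act_mult)

lemma lookup_eq_0:
  assumes "act f = - f" "\<phi> e = e"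
  shows "Poly_Mapping.lookup f e = 0"
  using lookup_act[of f e] assms by simp

end

definition swap_exponents :: "nat \<Rightarrow> nat \<Rightarrow> (nat \<Rightarrow>\<^sub>0 int) \<Rightarrow> (nat \<Rightarrow>\<^sub>0 int)" where
  "swap_exponents a b = Poly_Mapping.map_key (Transposition.transpose a b)"

definition negate_exponent :: "nat \<Rightarrow> (nat \<Rightarrow>\<^sub>0 int) \<Rightarrow> (nat \<Rightarrow>\<^sub>0 int)" where
  "negate_exponent a e = e - Poly_Mapping.single a (2 * Poly_Mapping.lookup e a)"

lemma lookup_swap_exponents:
  "Poly_Mapping.lookup (swap_exponents a b e) j = Poly_Mapping.lookup e (Transposition.transpose a b j)"
  by (simp add: swap_exponents_def map_key.rep_eq)

lemma lookup_negate_exponent: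
  "Poly_Mapping.lookup (negate_exponent a e) j = (if j = a then - 1 else 1) * Poly_Mapping.lookup e j"
  by (simp add: negate_exponent_def lookup_minus lookup_single)

interpretation swp: exponent_involution "swap_exponents a b" for a b
  by unfold_locales (auto intro!: poly_mapping_eqI simp: lookup_swap_exponents lookup_add)

interpretation neg: exponent_involution "negate_exponent a" for a
  by unfold_locales (auto intro!: poly_mapping_eqI simp: lookup_negate_exponent lookup_add algebra_simps)

lemma swap_exponents_single:
  "swap_exponents a b (Poly_Mapping.single j c) = Poly_Mapping.single (Transposition.transpose a b j) c"
  by (rule poly_mapping_eqI) (auto simp: lookup_swap_exponents lookup_single when_def)

lemma negate_exponent_single:
  "negate_exponent a (Poly_Mapping.single j c) = Poly_Mapping.single j (if j = a then - c else c)"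
  by (rule poly_mapping_eqI) (auto simp: lookup_negate_exponent lookup_single when_def)

lemma swap_lvar: "swp.act a b (lvar j) = lvar (Transposition.transpose a b j)"
  and swap_lvar_inv: "swp.act a b (lvar_inv j) = lvar_inv (Transposition.transpose a b j)"
  by (simp_all add: lvar_def lvar_inv_def swp.act_single swap_exponents_single)

lemma negate_lvar: "neg.act a (lvar j) = (if j = a then lvar_inv j else lvar j)"
  and negate_lvar_inv: "neg.act a (lvar_inv j) = (if j = a then lvar j else lvar_inv j)"
  by (simp_all add: lvar_def lvar_inv_def neg.act_single negate_exponent_single)

definition step_weight :: "nat \<Rightarrow> laurent" where
  "step_weight l = 1 + (\<Sum>j = 1..l. lvar j) + (\<Sum>j = 1..l. lvar_inv j)"

lemma swap_step_weight:
  assumes "a \<in> {1..l}" "b \<in> {1..l}"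
  shows "swp.act a b (step_weight l) = step_weight l"
  using sum.permute[OF permutes_swap_id[OF assms], of lvar]
    sum.permute[OF permutes_swap_id[OF assms], of lvar_inv]
  by (simp add: step_weight_def swp.act_1 swp.act_add swp.act_sum swap_lvar swap_lvar_inv o_def)

lemma negate_step_weight: "neg.act a (step_weight l) = step_weight l"
  by (simp add: step_weight_def neg.act_1 neg.act_add neg.act_sum negate_lvar negate_lvar_inv
      add.assoc flip: sum.distrib) (auto intro!: sum.cong)

lemma ordinary_matrix_carrier: "ordinary_matrix l \<in> carrier_mat l l"
  by (simp add: ordinary_matrix_def)

lemma swap_det:
  assumes "a < l" "b < l" "a \<noteq> b"
  shows "swp.act (Suc a) (Suc b) (det (ordinary_matrix l)) = - det (ordinary_matrix l)"
proof -
  have "map_mat (swp.act (Suc a) (Suc b)) (ordinary_matrix l) = swapcols a b (ordinary_matrix l)"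
    using assms
    by (intro eq_matI) (auto simp: ordinary_matrix_def swp.hom_minus swp.hom_power swp.act_mult swap_lvar swap_lvar_inv
        Transposition.transpose_def)
  then show ?thesis
    using det_swapcols[OF assms ordinary_matrix_carrier] by (simp flip: swp.hom_det)
qed

lemma negate_det:
  assumes "a < l"
  shows "neg.act (Suc a) (det (ordinary_matrix l)) = - det (ordinary_matrix l)"
proof -
  let ?A = "\<lambda>i j. lvar (j + 1) ^ (i + 1) - lvar_inv (j + 1) ^ (i + 1)"
  have "map_mat (neg.act (Suc a)) (ordinary_matrix l)
      = mat l l (\<lambda>(i, j). (if j = a then - 1 else 1) * ?A i j)"
    by (intro eq_matI) (auto simp: ordinary_matrix_def neg.hom_minus neg.hom_power neg.act_mult negate_lvar negate_lvar_inv)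
  then show ?thesis
    using assms by (simp add: det_scale_cols ordinary_matrix_def prod.delta flip: neg.hom_det)
qed

section \<open>The kernel identity\<close>

lemma lookup_staircase:
  "Poly_Mapping.lookup (staircase_exponent l) j = (if j \<in> {1..l} then int j else 0)"
  by (simp add: staircase_exponent_def lookup_sum lookup_single when_def)

definition rank_var :: "nat \<Rightarrow> nat \<Rightarrow> laurent" where
  "rank_var l r = (\<Sum>j = Suc r..l. lvar_inv j)"

lemma rank_var_step: "r < l \<Longrightarrow> rank_var l r = lvar_inv (Suc r) + rank_var l (Suc r)"
  by (simp add: rank_var_def sum.atLeast_Suc_atMost)

lemma swap_rank_var:
  assumes "0 < \<rho>" "\<rho> < l" "s \<noteq> \<rho>"
  shows "swp.act \<rho> (Suc \<rho>) (rank_var l s) = rank_var l s"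
proof (cases "s < \<rho>")
  case True
  then have "Transposition.transpose \<rho> (Suc \<rho>) permutes {Suc s..l}"
    using assms by (intro permutes_swap_id) auto
  from sum.permute[OF this, of lvar_inv] show ?thesis
    by (simp add: rank_var_def swp.act_sum swap_lvar_inv o_def)
next
  case False
  then have "Transposition.transpose \<rho> (Suc \<rho>) j = j" if "j \<in> {Suc s..l}" for j
    using that assms by (intro transpose_apply_other) auto
  then show ?thesis
    by (simp add: rank_var_def swp.act_sum swap_lvar_inv)
qed

lemma negate_rank_var: "0 < s \<Longrightarrow> neg.act (Suc 0) (rank_var l s) = rank_var l s"
  by (simp add: rank_var_def neg.act_sum negate_lvar_inv)

text \<open>
  Divided by \<open>x\<^sub>1 x\<^sub>2\<^sup>2 \<dots> x\<^sub>\<ell>\<^sup>\<ell>\<close>, the factor \<open>lvar (Suc \<rho>)\<close> leaves equal exponents of \<open>x\<^sub>\<rho>\<close> and \<open>x\<^sub>\<rho>\<^sub>+\<^sub>1\<close>,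
  and for \<open>\<rho> = 0\<close> no \<open>x\<^sub>1\<close> at all; the determinant is the only factor that is not invariant under
  the corresponding reflection, and it changes sign.
\<close>

lemma lookup_reflected_eq_0:
  assumes "\<rho> < l" and "\<And>j. j \<in> K \<Longrightarrow> r j \<noteq> \<rho>"
  shows "Poly_Mapping.lookup
    (lvar (Suc \<rho>) * (\<Prod>j\<in>K. rank_var l (r j)) * det (ordinary_matrix l) * step_weight l ^ N)
    (staircase_exponent l) = 0"
proof -
  let ?f = "(\<Prod>j\<in>K. rank_var l (r j)) * det (ordinary_matrix l) * step_weight l ^ N"
  let ?e = "staircase_exponent l - Poly_Mapping.single (Suc \<rho>) 1"
  have "Poly_Mapping.lookup ?f ?e = 0"
  proof (cases "\<rho> = 0")
    case True
    have "neg.act 1 ?f = - ?f"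
      using assms negate_det[of 0 l] True
      by (simp add: neg.act_mult neg.hom_prod neg.hom_power negate_step_weight negate_rank_var)
    moreover have "negate_exponent 1 ?e = ?e"
      using assms True
      by (intro poly_mapping_eqI)
         (simp add: lookup_negate_exponent lookup_minus lookup_staircase lookup_single when_def)
    ultimately show ?thesis
      by (rule neg.lookup_eq_0)
  next
    case False
    have "swp.act \<rho> (Suc \<rho>) ?f = - ?f"
      using assms False swap_det[of "\<rho> - 1" l \<rho>]
      by (simp add: swp.act_mult swp.hom_prod swp.hom_power swap_step_weight swap_rank_var)
    moreover have "swap_exponents \<rho> (Suc \<rho>) ?e = ?e"
      using assms False
      by (intro poly_mapping_eqI)
         (auto simp: lookup_swap_exponents lookup_minus lookup_staircase lookup_single when_def
           Transposition.transpose_def)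
    ultimately show ?thesis
      by (rule swp.lookup_eq_0)
  qed
  then show ?thesis
    by (simp add: mult.assoc lvar_def lookup_single_mult)
qed

definition total_exponent :: "nat \<Rightarrow> (nat \<Rightarrow>\<^sub>0 int) \<Rightarrow> int" where
  "total_exponent l e = (\<Sum>j = 1..l. Poly_Mapping.lookup e j)"

definition degree_le :: "nat \<Rightarrow> int \<Rightarrow> laurent \<Rightarrow> bool" where
  "degree_le l d f \<longleftrightarrow> (\<forall>e. Poly_Mapping.lookup f e \<noteq> 0 \<longrightarrow> total_exponent l e \<le> d)"

lemma total_exponent_add: "total_exponent l (a + b) = total_exponent l a + total_exponent l b"
  by (simp add: total_exponent_def lookup_add sum.distrib)

lemma degree_le_1: "degree_le l 0 1"
  by (simp add: degree_le_def lookup_one when_def total_exponent_def)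

lemma degree_le_mult: 
  assumes "degree_le l c f" "degree_le l d g"
  shows "degree_le l (c + d) (f * g)"
  unfolding degree_le_def
proof (intro allI impI)
  fix e assume "Poly_Mapping.lookup (f * g) e \<noteq> 0"
  then have "e \<in> Poly_Mapping.keys (f * g)"
    by (simp add: in_keys_iff)
  with keys_mult[of f g] obtain a b where "e = a + b" "a \<in> Poly_Mapping.keys f" "b \<in> Poly_Mapping.keys g"
    by blast
  with assms show "total_exponent l e \<le> c + d"
    by (auto simp: degree_le_def in_keys_iff total_exponent_add intro: add_mono)
qed

lemma degree_le_prod:
  "(\<And>i. i \<in> I \<Longrightarrow> degree_le l (d i) (f i)) \<Longrightarrow> degree_le l (\<Sum>i\<in>I. d i) (\<Prod>i\<in>I. f i)"
  by (induction I rule: infinite_finite_induct) (auto intro: degree_le_1 degree_le_mult)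

lemma degree_le_diff: "degree_le l d f \<Longrightarrow> degree_le l d g \<Longrightarrow> degree_le l d (f - g)"
  unfolding degree_le_def by (metis lookup_minus diff_zero)

lemma degree_le_sum: "(\<And>i. i \<in> I \<Longrightarrow> degree_le l d (f i)) \<Longrightarrow> degree_le l d (\<Sum>i\<in>I. f i)"
  unfolding degree_le_def lookup_sum by (metis sum.neutral)

lemma degree_le_single: "total_exponent l k \<le> d \<Longrightarrow> degree_le l d (Poly_Mapping.single k v)"
  by (auto simp: degree_le_def lookup_single when_def)

lemma total_exponent_single:
  "total_exponent l (Poly_Mapping.single j c) = (if j \<in> {1..l} then c else 0)"
  by (simp add: total_exponent_def lookup_single when_def)

lemma lvar_power: "lvar j ^ n = Poly_Mapping.single (Poly_Mapping.single j (int n)) 1"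
  by (induction n) (simp_all add: lvar_def mult_single single_one flip: single_add)

lemma lvar_inv_power: "lvar_inv j ^ n = Poly_Mapping.single (Poly_Mapping.single j (- int n)) 1"
  by (induction n) (simp_all add: lvar_inv_def mult_single single_one flip: single_add)

lemma det_ordinary_matrix:
  "det (ordinary_matrix l) = (\<Sum>p | p permutes {0..<l}.
     signof p * (\<Prod>j<l. lvar (Suc j) ^ Suc (p j) - lvar_inv (Suc j) ^ Suc (p j)))"
proof -
  have "p j < l" if "p permutes {0..<l}" "j < l" for p j
    using permutes_in_image[OF that(1), of j] that by simp
  then show ?thesis
    by (subst det_col[OF ordinary_matrix_carrier])
       (auto intro!: sum.cong prod.cong arg_cong2[of _ _ _ _ "(*)"] simp: ordinary_matrix_def)
qed

lemma degree_le_det: "degree_le l (\<Sum>j = 1..l. int j) (det (ordinary_matrix l))"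
  unfolding det_ordinary_matrix
proof (rule degree_le_sum)
  fix p assume "p \<in> {p. p permutes {0..<l}}"
  then have "p permutes {..<l}"
    by (simp add: atLeast0LessThan)
  have "(\<Sum>j = 1..l. int j) = (\<Sum>j<l. int (Suc j))"
    by (rule sum.reindex_bij_witness[of _ Suc "\<lambda>j. j - 1"]) auto
  also have "\<dots> = (\<Sum>j<l. int (Suc (p j)))"
    using sum.permute[OF \<open>p permutes {..<l}\<close>, of "\<lambda>j. int (Suc j)"] by (simp add: o_def)
  finally have *: "(\<Sum>j = 1..l. int j) = 0 + (\<Sum>j<l. int (Suc (p j)))"
    by simp
  show "degree_le l (\<Sum>j = 1..l. int j)
      (signof p * (\<Prod>j<l. lvar (Suc j) ^ Suc (p j) - lvar_inv (Suc j) ^ Suc (p j)))"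
    unfolding *
  proof (intro degree_le_mult degree_le_prod degree_le_diff)
    show "degree_le l 0 (signof p)"
      by (simp add: sign_def degree_le_def lookup_one when_def total_exponent_def)
  qed (simp_all only: lvar_power lvar_inv_power, auto intro!: degree_le_single simp: total_exponent_single)
qed

lemma lookup_prod_diff_staircase:
  "Poly_Mapping.lookup (\<Prod>j<l. lvar (Suc j) ^ Suc (p j) - lvar_inv (Suc j) ^ Suc (p j)) (staircase_exponent l)
   = (if \<forall>j<l. p j = j then 1 else 0)"
proof -
  let ?E = "\<lambda>X. (\<Sum>j\<in>X. Poly_Mapping.single (Suc j) (- int (Suc (p j))))
              + (\<Sum>j\<in>{..<l} - X. Poly_Mapping.single (Suc j) (int (Suc (p j))))"
  have prod_single: "(\<Prod>j\<in>I. Poly_Mapping.single (e j) 1) = (Poly_Mapping.single (\<Sum>j\<in>I. e j) 1 :: laurent)"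
    if "finite I" for I :: "nat set" and e
    using that by induction (simp_all add: mult_single single_one)
  have E: "Poly_Mapping.lookup (?E X) (Suc j) = (if j \<in> X then - int (Suc (p j)) else int (Suc (p j)))"
    if "X \<subseteq> {..<l}" "j < l" for X j
    using that finite_subset[OF that(1)]
    by (auto simp: lookup_add lookup_sum lookup_single when_def simp del: of_nat_Suc)
  have eq: "?E X = staircase_exponent l \<longleftrightarrow> X = {} \<and> (\<forall>j<l. p j = j)" if "X \<subseteq> {..<l}" for X
  proof
    assume *: "?E X = staircase_exponent l"
    have "(if j \<in> X then - int (Suc (p j)) else int (Suc (p j))) = int (Suc j)" if "j < l" for j
      using E[OF \<open>X \<subseteq> {..<l}\<close> that] that by (simp add: * lookup_staircase del: of_nat_Suc)
    then have "j \<notin> X \<and> p j = j" if "j < l" for j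
      using that by (fastforce split: if_splits)
    with that show "X = {} \<and> (\<forall>j<l. p j = j)"
      by blast
  next
    assume *: "X = {} \<and> (\<forall>j<l. p j = j)"
    have "(\<Sum>j<l. Poly_Mapping.single (Suc j) (int (Suc j))) = staircase_exponent l"
      unfolding staircase_exponent_def
      by (rule sum.reindex_bij_witness[of _ "\<lambda>j. j - 1" Suc]) auto
    with * show "?E X = staircase_exponent l"
      by simp
  qed
  have "Poly_Mapping.lookup (\<Prod>j<l. lvar (Suc j) ^ Suc (p j) - lvar_inv (Suc j) ^ Suc (p j)) (staircase_exponent l)
      = (\<Sum>X\<in>Pow {..<l}. (- 1) ^ card X * Poly_Mapping.lookup
           (Poly_Mapping.single (?E X) 1 :: laurent) (staircase_exponent l))"
    by (subst prod_diff_conv_sum)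
       (auto simp: lookup_sum mult.assoc lookup_sign_mult lvar_power lvar_inv_power prod_single mult_single
         finite_subset simp del: power_Suc of_nat_Suc intro!: sum.cong)
  also have "\<dots> = (\<Sum>X\<in>Pow {..<l}. if X = {} then if \<forall>j<l. p j = j then 1 else 0 else 0)"
    by (intro sum.cong refl) (simp only: lookup_single when_def eq Pow_iff, simp)
  finally show ?thesis
    by simp
qed

lemma lookup_det_staircase:
  "Poly_Mapping.lookup (det (ordinary_matrix l)) (staircase_exponent l) = 1"
proof -
  have *: "(\<forall>j<l. p j = j) \<longleftrightarrow> p = id" if "p permutes {0..<l}" for p
    using permutes_not_in[OF that] by (auto simp: fun_eq_iff)
  have "Poly_Mapping.lookup (det (ordinary_matrix l)) (staircase_exponent l)
      = (\<Sum>p | p permutes {0..<l}. signof p * (if \<forall>j<l. p j = j then 1 else 0))"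
    unfolding det_ordinary_matrix lookup_sum lookup_signof_mult lookup_prod_diff_staircase ..
  also have "\<dots> = (\<Sum>p | p permutes {0..<l}. if p = id then 1 else 0)"
    by (intro sum.cong refl) (simp add: *)
  also have "\<dots> = 1"
    by (simp add: finite_permutations permutes_id)
  finally show ?thesis .
qed

lemma lookup_base:
  assumes "finite K"
  shows "Poly_Mapping.lookup ((\<Prod>j\<in>K. rank_var l (r j)) * det (ordinary_matrix l)) (staircase_exponent l)
    = (if K = {} then 1 else 0)"
proof (cases "K = {}")
  case False
  have "degree_le l (- 1) (rank_var l s)" for s
    unfolding rank_var_def lvar_inv_def
    by (intro degree_le_sum degree_le_single) (auto simp: total_exponent_single)
  then have "degree_le l ((\<Sum>j\<in>K. - 1) + (\<Sum>j = 1..l. int j))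
      ((\<Prod>j\<in>K. rank_var l (r j)) * det (ordinary_matrix l))"
    by (intro degree_le_mult degree_le_prod degree_le_det)
  moreover have "total_exponent l (staircase_exponent l) = (\<Sum>j = 1..l. int j)"
    by (simp add: total_exponent_def lookup_staircase)
  moreover have "card K > 0"
    using False assms by (simp add: card_gt_0_iff)
  ultimately show ?thesis
    using False by (auto simp: degree_le_def)
qed (simp add: lookup_det_staircase)

lemma telescoping_prod:
  fixes a b :: "'a :: comm_ring_1" and B :: "nat set"
  assumes "finite B"
  shows "(b - a) * (\<Sum>i\<in>B. \<Prod>j\<in>B - {i}. if j < i then a else b) = b ^ card B - a ^ card B"
  using assms
proof (induction B rule: finite_linorder_max_induct)
  case (insert m B)
  let ?S = "\<Sum>i\<in>B. \<Prod>j\<in>B - {i}. if j < i then a else b"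
  have [simp]: "m \<notin> B"
    using insert by auto
  have "(\<Prod>j\<in>insert m B - {i}. if j < i then a else b) = b * (\<Prod>j\<in>B - {i}. if j < i then a else b)"
    if "i \<in> B" for i
  proof -
    have "insert m B - {i} = insert m (B - {i})" "\<not> m < i"
      using that insert by auto
    then show ?thesis
      using insert by simp
  qed
  moreover have "(\<Prod>j\<in>insert m B - {m}. if j < m then a else b) = a ^ card B"
    using insert by (simp flip: prod_constant)
  ultimately have "(\<Sum>i\<in>insert m B. \<Prod>j\<in>insert m B - {i}. if j < i then a else b) = a ^ card B + b * ?S"
    using insert by (simp add: sum_distrib_left)
  moreover have "(b - a) * (a ^ card B + b * ?S) = (b - a) * a ^ card B + b * ((b - a) * ?S)"
    by (simp add: algebra_simps)
  moreover have "\<dots> = b ^ card (insert m B) - a ^ card (insert m B)"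
    using insert.hyps unfolding insert.IH by (simp add: algebra_simps)
  ultimately show ?case
    by simp
qed simp

definition raise_ranks :: "nat \<Rightarrow> (nat \<Rightarrow> nat) \<Rightarrow> nat \<Rightarrow> nat" where
  "raise_ranks i r j = (if j < i then max (r j) (Suc (r i)) else r j)"

lemma sum_close_rank:
  assumes "finite K" "antimono_on K r" "\<rho> < l"
  shows "(\<Sum>i | i \<in> K \<and> r i = \<rho>. \<Prod>j\<in>K - {i}. rank_var l (raise_ranks i r j))
    = lvar (Suc \<rho>) * ((\<Prod>j\<in>K. rank_var l (r j)) - (\<Prod>j\<in>K. rank_var l (if r j = \<rho> then Suc \<rho> else r j)))"
    (is "?L = _ * (?Q - ?Q')")
proof -
  define B where "B = {i \<in> K. r i = \<rho>}"
  define P where "P = (\<Prod>j\<in>K - B. rank_var l (r j))"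
  let ?a = "rank_var l (Suc \<rho>)" and ?b = "rank_var l \<rho>"
  have B: "finite B" "B \<subseteq> K"
    using assms by (auto simp: B_def)
  have split: "prod f K = prod f (K - B) * prod f B" for f :: "nat \<Rightarrow> laurent"
    using B assms by (metis prod.subset_diff)
  have "(\<Prod>j\<in>K - {i}. rank_var l (raise_ranks i r j)) = P * (\<Prod>j\<in>B - {i}. if j < i then ?a else ?b)"
    if "i \<in> B" for i
  proof -
    have "K - {i} = (K - B) \<union> (B - {i})"
      using that B by auto
    moreover have "raise_ranks i r j = r j" if "j \<in> K - B" for j
    proof -
      have "r i \<le> r j" if "j < i"
        using monotone_onD[OF assms(2), of j i] that \<open>i \<in> B\<close> \<open>j \<in> K - B\<close> B by auto
      moreover have "r j \<noteq> r i"
        using that \<open>i \<in> B\<close> by (auto simp: B_def)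
      ultimately show ?thesis
        by (auto simp: raise_ranks_def)
    qed
    moreover have "rank_var l (raise_ranks i r j) = (if j < i then ?a else ?b)" if "j \<in> B - {i}" for j
      using that \<open>i \<in> B\<close> by (auto simp: raise_ranks_def B_def)
    ultimately show ?thesis
      using assms B by (subst \<open>K - {i} = _\<close>, subst prod.union_disjoint) (auto simp: P_def)
  qed
  then have L: "?L = P * (\<Sum>i\<in>B. \<Prod>j\<in>B - {i}. if j < i then ?a else ?b)"
    by (simp add: sum_distrib_left B_def)
  have "?Q = P * ?b ^ card B" "?Q' = P * ?a ^ card B"
    unfolding split P_def by (auto simp: B_def intro!: arg_cong2[of _ _ _ _ "(*)"] prod.cong)
  then have "?Q - ?Q' = P * (?b ^ card B - ?a ^ card B)"
    by (simp add: right_diff_distrib)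
  also have "\<dots> = (?b - ?a) * ?L"
    unfolding L telescoping_prod[OF B(1), symmetric] by (rule mult.left_commute)
  also have "?b - ?a = lvar_inv (Suc \<rho>)"
    using rank_var_step[OF assms(3)] by simp
  finally show ?thesis
    using lvar_mult_lvar_inv[of "Suc \<rho>"] by (simp add: mult.assoc[symmetric])
qed

definition completion_weight :: "nat \<Rightarrow> nat set \<Rightarrow> (nat \<Rightarrow> nat) \<Rightarrow> nat \<Rightarrow> rat" where
  "completion_weight l K r N = Poly_Mapping.lookup
     ((\<Prod>j\<in>K. rank_var l (r j)) * det (ordinary_matrix l) * step_weight l ^ N) (staircase_exponent l)"

lemma completion_weight_0: "finite K \<Longrightarrow> completion_weight l K r 0 = (if K = {} then 1 else 0)"
  by (simp add: completion_weight_def lookup_base)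

lemma completion_weight_Suc:
  assumes K: "finite K" "antimono_on K r" and p: "p \<notin> K" "r p = 0"
  shows "completion_weight l K r (Suc N) = completion_weight l K r N + completion_weight l (insert p K) r N
    + (\<Sum>i | i \<in> K \<and> r i < l. completion_weight l (K - {i}) (raise_ranks i r) N)"
proof -
  let ?w = "\<lambda>f. Poly_Mapping.lookup (f * det (ordinary_matrix l) * step_weight l ^ N) (staircase_exponent l)"
  let ?Q = "\<Prod>j\<in>K. rank_var l (r j)"
  let ?Q' = "\<lambda>\<rho>. \<Prod>j\<in>K. rank_var l (if r j = \<rho> then Suc \<rho> else r j)"
  let ?C = "\<lambda>i. \<Prod>j\<in>K - {i}. rank_var l (raise_ranks i r j)"
  have w_add: "?w (f + g) = ?w f + ?w g" for f g
    by (simp add: distrib_right lookup_add)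
  have w_sum: "?w (sum f I) = (\<Sum>i\<in>I. ?w (f i))" for f :: "nat \<Rightarrow> laurent" and I
    by (simp add: sum_distrib_right lookup_sum)
  have "(\<Sum>i | i \<in> K \<and> r i < l. ?C i) = (\<Sum>\<rho><l. \<Sum>i | i \<in> K \<and> r i = \<rho>. ?C i)"
    using K by (subst sum.group[symmetric, of _ "{..<l}" r]) (auto intro!: sum.cong)
  also have "\<dots> = (\<Sum>\<rho><l. lvar (Suc \<rho>) * (?Q - ?Q' \<rho>))"
    using K by (intro sum.cong sum_close_rank) auto
  finally have "(\<Sum>i | i \<in> K \<and> r i < l. ?C i) + (\<Sum>\<rho><l. lvar (Suc \<rho>) * ?Q' \<rho>) = (\<Sum>\<rho><l. lvar (Suc \<rho>)) * ?Q"
    by (simp add: right_diff_distrib sum_subtractf sum_distrib_right)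
  moreover have "(\<Sum>\<rho><l. lvar (Suc \<rho>)) = (\<Sum>j = 1..l. lvar j)"
    by (rule sum.reindex_bij_witness[of _ "\<lambda>j. j - 1" Suc]) auto
  ultimately have "?Q * step_weight l
      = ?Q + rank_var l 0 * ?Q + ((\<Sum>i | i \<in> K \<and> r i < l. ?C i) + (\<Sum>\<rho><l. lvar (Suc \<rho>) * ?Q' \<rho>))"
    by (simp add: step_weight_def rank_var_def algebra_simps)
  then have "?w (?Q * step_weight l)
      = ?w ?Q + ?w (rank_var l 0 * ?Q) + ((\<Sum>i | i \<in> K \<and> r i < l. ?w (?C i)) + (\<Sum>\<rho><l. ?w (lvar (Suc \<rho>) * ?Q' \<rho>)))"
    by (simp only: w_add w_sum)
  moreover have "?w (lvar (Suc \<rho>) * ?Q' \<rho>) = 0" if "\<rho> < l" for \<rho>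
    using that by (intro lookup_reflected_eq_0) auto
  ultimately show ?thesis
    using K p by (simp add: completion_weight_def mult_ac)
qed

section \<open>Completing involutions from left to right\<close>

definition nest :: "(nat \<Rightarrow> nat) \<Rightarrow> nat set \<Rightarrow> bool" where
  "nest \<tau> A \<longleftrightarrow> finite A \<and> (\<forall>i\<in>A. i < \<tau> i) \<and> (\<forall>i\<in>A. \<forall>j\<in>A. i < j \<longrightarrow> \<tau> j < \<tau> i)"

definition nests_bounded :: "nat \<Rightarrow> (nat \<Rightarrow> nat) \<Rightarrow> (nat \<Rightarrow> nat) \<Rightarrow> bool" where
  "nests_bounded l r \<tau> \<longleftrightarrow> (\<forall>A. nest \<tau> A \<and> A \<noteq> {} \<longrightarrow> card A + r (Max A) \<le> l)"

text \<open>
  \<open>K\<close> is the set of points already read whose partner is still to come, \<open>R\<close> the set of unread points,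
  and \<open>r i\<close> the size of the largest nest among the closed cycles to the right of the opener \<open>i\<close>.
\<close>

definition completions :: "nat \<Rightarrow> nat set \<Rightarrow> (nat \<Rightarrow> nat) \<Rightarrow> nat set \<Rightarrow> (nat \<Rightarrow> nat) set" where
  "completions l K r R =
     {\<tau>. \<tau> permutes (K \<union> R) \<and> \<tau> \<circ> \<tau> = id \<and> \<tau> ` K \<subseteq> R \<and> nests_bounded l r \<tau>}"

lemma nests_bounded_close_iff:
  assumes \<tau>: "\<tau> i = p" "\<tau> p = i" "\<And>j. j \<noteq> i \<Longrightarrow> j \<noteq> p \<Longrightarrow> \<tau> j = \<tau>' j"
    and \<tau>': "\<tau>' i = i" "\<tau>' p = p"
    and "i < p" and above: "\<And>j. j < \<tau>' j \<Longrightarrow> p < \<tau>' j"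
  shows "nests_bounded l r \<tau> \<longleftrightarrow> r i < l \<and> nests_bounded l (raise_ranks i r) \<tau>'"
proof
  assume bounded: "nests_bounded l r \<tau>"
  have "nest \<tau> {i}"
    using \<tau> \<open>i < p\<close> by (simp add: nest_def)
  then have "r i < l"
    using bounded unfolding nests_bounded_def by fastforce
  moreover have "card A + raise_ranks i r (Max A) \<le> l" if A: "nest \<tau>' A" "A \<noteq> {}" for A
  proof -
    have [simp]: "finite A" and "i \<notin> A" "p \<notin> A"
      using A \<tau>' by (auto simp: nest_def)
    then have eq: "\<tau> j = \<tau>' j" if "j \<in> A" for j
      using that \<tau>(3) by metis
    then have "nest \<tau> A"
      using A by (simp add: nest_def)
    then have "card A + r (Max A) \<le> l"
      using bounded A by (simp add: nests_bounded_def)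
    moreover have "card A + Suc (r i) \<le> l" if "Max A < i"
    proof -
      have below: "j < i" and "p < \<tau> j" if "j \<in> A" for j
        using that A above eq \<open>Max A < i\<close> by (auto simp: nest_def)
      then have "nest \<tau> (insert i A)"
        using \<open>nest \<tau> A\<close> \<tau>(1) \<open>i < p\<close> by (auto simp: nest_def dest: less_asym)
      moreover have "Max (insert i A) = i"
        by (intro Max_eqI) (auto dest: below intro: less_imp_le)
      ultimately show ?thesis
        using bounded \<open>i \<notin> A\<close> unfolding nests_bounded_def by fastforce
    qed
    ultimately show ?thesis
      by (auto simp: raise_ranks_def max_def)
  qed
  ultimately show "r i < l \<and> nests_bounded l (raise_ranks i r) \<tau>'"
    by (simp add: nests_bounded_def)
next
  assume asm: "r i < l \<and> nests_bounded l (raise_ranks i r) \<tau>'"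
  have "card A + r (Max A) \<le> l" if A: "nest \<tau> A" "A \<noteq> {}" for A
  proof -
    let ?A = "A - {i}"
    have fin [simp]: "finite A" and "p \<notin> A"
      using A \<tau> \<open>i < p\<close> by (auto simp: nest_def)
    then have eq: "\<tau> j = \<tau>' j" if "j \<in> ?A" for j
      using that \<tau>(3) by auto
    moreover have "nest \<tau> ?A"
      using A by (auto simp: nest_def)
    ultimately have "nest \<tau>' ?A"
      by (simp add: nest_def)
    then have le: "card ?A + raise_ranks i r (Max ?A) \<le> l" if "?A \<noteq> {}"
      using that asm by (simp add: nests_bounded_def)
    show ?thesis
    proof (cases "i \<in> A")
      case False
      then show ?thesis
        using le A by (auto simp: raise_ranks_def split: if_splits)
    next
      case True
      have below: "j < i" if "j \<in> ?A" for j
      proof (rule ccontr)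
        assume "\<not> j < i"
        then have "\<tau> j < p"
          using that A True \<tau> by (auto simp: nest_def)
        moreover have "p < \<tau> j"
          using that A above[of j] eq[OF that] by (auto simp: nest_def)
        ultimately show False
          by simp
      qed
      then have "Max A = i"
        using True by (intro Max_eqI) (auto intro: less_imp_le)
      moreover have "card A = Suc (card ?A)"
        using fin True by (rule card.remove)
      moreover have "card ?A + Suc (r i) \<le> l"
      proof (cases "?A = {}")
        case True
        then have "card ?A = 0"
          by (simp only: card.empty)
        then show ?thesis
          using conjunct1[OF asm] by linarith
      next
        case False
        then have "Max ?A < i"
          using below by (metis Max_in fin finite_Diff)
        then show ?thesis
          using le[OF False] by (simp add: raise_ranks_def)
      qed
      ultimately show ?thesis
        by simp
    qed
  qed
  then show "nests_bounded l r \<tau>"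
    by (simp add: nests_bounded_def)
qed

lemma involution_apply: "\<tau> \<circ> \<tau> = id \<Longrightarrow> \<tau> (\<tau> x) = x"
  by (metis comp_apply id_apply)

lemma nest_subset: "\<tau> permutes S \<Longrightarrow> nest \<tau> A \<Longrightarrow> A \<subseteq> S"
  by (metis less_irrefl nest_def permutes_not_in subsetI)

lemma finite_completions: "finite K \<Longrightarrow> finite R \<Longrightarrow> finite (completions l K r R)"
  by (rule finite_subset[of _ "{\<tau>. \<tau> permutes (K \<union> R)}"]) (auto simp: completions_def finite_permutations)

lemma completions_fixed:
  assumes "p \<notin> K" "p \<notin> R"
  shows "{\<tau> \<in> completions l K r (insert p R). \<tau> p = p} = completions l K r R"
proof (intro equalityI subsetI)
  fix \<tau> assume *: "\<tau> \<in> {\<tau> \<in> completions l K r (insert p R). \<tau> p = p}"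
  then have \<tau>: "\<tau> permutes (K \<union> insert p R)" "\<tau> p = p" "\<tau> \<circ> \<tau> = id" "\<tau> ` K \<subseteq> insert p R"
    by (auto simp: completions_def)
  have "\<tau> permutes (K \<union> R)"
    using \<tau>(1) by (rule permutes_superset) (use \<tau>(2) in auto)
  moreover have "\<tau> k \<noteq> p" if "k \<in> K" for k
    using that \<tau> assms involution_apply by metis
  ultimately show "\<tau> \<in> completions l K r R"
    using * by (auto simp: completions_def)
next
  fix \<tau> assume *: "\<tau> \<in> completions l K r R"
  then have "\<tau> permutes (K \<union> R)"
    by (simp add: completions_def)
  moreover from this have "\<tau> permutes (K \<union> insert p R)" 
    by (rule permutes_subset) auto
  ultimately show "\<tau> \<in> {\<tau> \<in> completions l K r (insert p R). \<tau> p = p}"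
    using * assms by (auto simp: completions_def permutes_not_in)
qed

lemma completions_open:
  assumes "p \<notin> K" "p \<notin> R" "K \<inter> R = {}"
  shows "{\<tau> \<in> completions l K r (insert p R). \<tau> p \<in> R} = completions l (insert p K) r R"
proof -
  have "\<tau> k \<noteq> p" if "\<tau> \<circ> \<tau> = id" "k \<in> K" "\<tau> p \<in> R" for \<tau> k
    using that assms involution_apply[OF that(1)] by (metis disjoint_iff)
  then show ?thesis
    by (auto simp: completions_def insert_commute image_subset_iff)
qed

lemma close_completion:
  assumes "i \<in> K" and KR: "\<And>k. k \<in> K \<Longrightarrow> k < p" "\<And>q. q \<in> R \<Longrightarrow> p < q"
  shows "\<tau> \<in> completions l K r (insert p R) \<and> \<tau> p = i \<longleftrightarrow>
    r i < l \<and> \<tau> \<circ> Transposition.transpose i p \<in> completions l (K - {i}) (raise_ranks i r) R"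
    (is "?lhs \<longleftrightarrow> r i < l \<and> ?\<tau> \<in> ?C")
proof -
  have "i < p"
    using assms by simp
  have disj: "i \<notin> R" "p \<notin> K" "p \<notin> R"
    using KR \<open>i \<in> K\<close> by fastforce+
  have iff: "nests_bounded l r \<tau> \<longleftrightarrow> r i < l \<and> nests_bounded l (raise_ranks i r) ?\<tau>"
    if \<tau>: "\<tau> i = p" "\<tau> p = i" and perm: "?\<tau> permutes (K - {i} \<union> R)" and img: "?\<tau> ` (K - {i}) \<subseteq> R"
  proof (rule nests_bounded_close_iff[OF \<tau>])
    fix j assume j: "j < ?\<tau> j"
    show "p < ?\<tau> j"
    proof (cases "j \<in> K - {i}")
      case True
      then show ?thesis
        using img KR(2) by blast
    next
      case False
      then have "j \<in> R"
        using j permutes_not_in[OF perm, of j] by auto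
      then show ?thesis
        using KR(2)[of j] j by simp
    qed
  next
    show "\<tau> j = ?\<tau> j" if "j \<noteq> i" "j \<noteq> p" for j
      using that by (simp add: transpose_apply_other)
  qed (simp_all add: \<tau> \<open>i < p\<close>)
  show ?thesis
  proof
    assume ?lhs
    then have \<tau>: "\<tau> permutes (K \<union> insert p R)" "\<tau> \<circ> \<tau> = id" "\<tau> ` K \<subseteq> insert p R" "nests_bounded l r \<tau>"
      and p: "\<tau> p = i"
      by (auto simp: completions_def)
    have inv: "\<tau> (\<tau> x) = x" for x
      using \<tau>(2) by (rule involution_apply)
    have i: "\<tau> i = p"
      using inv[of p] p by simp
    have eq: "?\<tau> x = (if x = i \<or> x = p then x else \<tau> x)" for x
      using i p by (auto simp: Transposition.transpose_def)
    have "Transposition.transpose i p permutes (K \<union> insert p R)"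
      using \<open>i \<in> K\<close> by (intro permutes_swap_id) auto
    then have "?\<tau> permutes (K \<union> insert p R)"
      using \<tau>(1) by (rule permutes_compose)
    then have perm: "?\<tau> permutes (K - {i} \<union> R)"
      by (rule permutes_superset) (use eq in \<open>auto simp del: comp_apply\<close>)
    have img: "?\<tau> ` (K - {i}) \<subseteq> R"
    proof (rule image_subsetI)
      fix k assume k: "k \<in> K - {i}"
      then have "\<tau> k \<noteq> p"
        using i inv by (metis DiffD2 insertI1)
      moreover have "?\<tau> k = \<tau> k"
        using k disj eq[of k] by (auto simp del: comp_apply)
      ultimately show "?\<tau> k \<in> R"
        using \<tau>(3) k by (auto simp del: comp_apply)
    qed
    have "?\<tau> (?\<tau> x) = x" for x
    proof (cases "x = i \<or> x = p")
      case False
      then have "\<tau> x \<noteq> i" "\<tau> x \<noteq> p"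
        using inv[of x] i p by auto
      with False show ?thesis
        by (simp add: eq inv del: comp_apply)
    qed (auto simp only: eq if_True simp_thms)
    then have "?\<tau> \<circ> ?\<tau> = id"
      by (simp add: fun_eq_iff)
    then show "r i < l \<and> ?\<tau> \<in> ?C"
      using iff[OF i p perm img] \<tau>(4) perm img by (simp add: completions_def)
  next
    assume asm: "r i < l \<and> ?\<tau> \<in> ?C"
    then have perm: "?\<tau> permutes (K - {i} \<union> R)" and inv: "?\<tau> \<circ> ?\<tau> = id" and img: "?\<tau> ` (K - {i}) \<subseteq> R"
      and b: "nests_bounded l (raise_ranks i r) ?\<tau>"
      by (auto simp: completions_def)
    have fixed: "?\<tau> i = i" "?\<tau> p = p"
      by (rule permutes_not_in[OF perm]; use disj in simp)+
    then have p: "\<tau> p = i" and i: "\<tau> i = p"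
      by simp_all
    have eq: "\<tau> x = ?\<tau> x" if "x \<noteq> i" "x \<noteq> p" for x
      using that by (simp add: transpose_apply_other)
    have "?\<tau> permutes (K \<union> insert p R)"
      using perm by (rule permutes_subset) auto
    moreover have "Transposition.transpose i p permutes (K \<union> insert p R)"
      using \<open>i \<in> K\<close> by (intro permutes_swap_id) auto
    ultimately have "?\<tau> \<circ> Transposition.transpose i p permutes (K \<union> insert p R)"
      by (rule permutes_compose[rotated])
    then have perm': "\<tau> permutes (K \<union> insert p R)"
      by (simp add: comp_assoc)
    have "\<tau> (\<tau> x) = x" for x
    proof (cases "x = i \<or> x = p")
      case False
      then have "?\<tau> x \<noteq> i" "?\<tau> x \<noteq> p"
        using involution_apply[OF inv, of x] fixed by metis+
      then show ?thesis
        using False eq involution_apply[OF inv, of x] by metis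
    qed (use i p in auto)
    then have "\<tau> \<circ> \<tau> = id"
      by (simp add: fun_eq_iff)
    moreover have "\<tau> ` K \<subseteq> insert p R"
    proof (rule image_subsetI)
      fix k assume "k \<in> K"
      then show "\<tau> k \<in> insert p R"
        using i img eq[of k] disj by (cases "k = i") (auto simp del: comp_apply)
    qed
    ultimately show ?lhs
      using iff[OF i p perm img] asm b perm' p by (simp add: completions_def)
  qed
qed

lemma card_completions_insert:
  assumes fin: "finite K" "finite R" and KR: "\<And>k. k \<in> K \<Longrightarrow> k < p" "\<And>q. q \<in> R \<Longrightarrow> p < q"
  shows "card (completions l K r (insert p R)) = card (completions l K r R)
    + card (completions l (insert p K) r R)
    + (\<Sum>i | i \<in> K \<and> r i < l. card (completions l (K - {i}) (raise_ranks i r) R))"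
proof -
  let ?C = "completions l K r (insert p R)"
  let ?F = "\<lambda>i. {\<tau> \<in> ?C. \<tau> p = i}"
  have disj: "p \<notin> K" "p \<notin> R" "K \<inter> R = {}"
    using KR by fastforce+
  have C: "finite ?C"
    using fin by (simp add: finite_completions)
  have "\<tau> p \<in> K \<union> insert p R" if "\<tau> \<in> ?C" for \<tau>
    using that permutes_in_image[of \<tau> "K \<union> insert p R" p] by (simp add: completions_def)
  then have "?C = completions l K r R \<union> completions l (insert p K) r R \<union> (\<Union>i\<in>K. ?F i)"
    unfolding completions_fixed[OF disj(1,2), symmetric] completions_open[OF disj, symmetric] by auto
  then have "card ?C = card (completions l K r R \<union> completions l (insert p K) r R \<union> (\<Union>i\<in>K. ?F i))"
    by (rule arg_cong)
  moreover have "completions l K r R \<inter> completions l (insert p K) r R = {}"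
    "(completions l K r R \<union> completions l (insert p K) r R) \<inter> (\<Union>i\<in>K. ?F i) = {}"
    unfolding completions_fixed[OF disj(1,2), symmetric] completions_open[OF disj, symmetric]
    using disj by auto
  moreover have "finite (\<Union>i\<in>K. ?F i)"
    using C by (rule finite_subset[rotated]) auto
  ultimately have "card ?C = card (completions l K r R) + card (completions l (insert p K) r R)
      + card (\<Union>i\<in>K. ?F i)"
    using fin by (simp only: card_Un_disjoint finite_completions finite_Un finite_insert simp_thms)
  also have "card (\<Union>i\<in>K. ?F i) = (\<Sum>i\<in>K. card (?F i))"
    using fin C by (intro card_UN_disjoint) auto
  also have "\<dots> = (\<Sum>i\<in>K. if r i < l then card (completions l (K - {i}) (raise_ranks i r) R) else 0)"
  proof (intro sum.cong refl)
    fix i assume i: "i \<in> K"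
    let ?t = "\<lambda>\<tau>. \<tau> \<circ> Transposition.transpose i p"
    have tt: "?t (?t \<tau>) = \<tau>" for \<tau> :: "nat \<Rightarrow> nat"
      by (simp add: comp_assoc)
    note iff = close_completion[OF i KR, where l = l and r = r]
    show "card (?F i) = (if r i < l then card (completions l (K - {i}) (raise_ranks i r) R) else 0)"
    proof (cases "r i < l")
      case True
      have "bij_betw ?t (?F i) (completions l (K - {i}) (raise_ranks i r) R)"
        using iff tt True by (intro bij_betw_byWitness[where f' = ?t]) auto
      then show ?thesis
        using True bij_betw_same_card by auto
    next
      case False
      then have "?F i = {}"
        using iff by blast
      then show ?thesis
        using False by (simp only: if_False card.empty)
    qed
  qed
  also have "\<dots> = (\<Sum>i | i \<in> K \<and> r i < l. card (completions l (K - {i}) (raise_ranks i r) R))"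
    using fin by (simp add: sum.inter_filter)
  finally show ?thesis .
qed

lemma card_completions:
  assumes "finite R" "finite K" "antimono_on K r" "\<And>q. q \<in> R \<Longrightarrow> r q = 0" "\<And>k q. k \<in> K \<Longrightarrow> q \<in> R \<Longrightarrow> k < q"
  shows "of_nat (card (completions l K r R)) = completion_weight l K r (card R)"
  using assms
proof (induction R arbitrary: K r rule: finite_linorder_min_induct)
  case empty
  have "completions l K r {} = (if K = {} then {id} else {})"
    by (auto simp: completions_def nests_bounded_def nest_def)
  then show ?case
    using empty by (simp add: completion_weight_0)
next
  case (insert p R)
  have p: "p \<notin> K" "p \<notin> R" "r p = 0"
    using insert.prems insert.hyps by auto
  have "of_nat (card (completions l (K - {i}) (raise_ranks i r) R))
      = completion_weight l (K - {i}) (raise_ranks i r) (card R)" if "i \<in> K" for i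
  proof (rule insert.IH)
    show "antimono_on (K - {i}) (raise_ranks i r)"
    proof (rule monotone_onI)
      fix x y assume "x \<in> K - {i}" "y \<in> K - {i}" "x \<le> y"
      then show "raise_ranks i r y \<le> raise_ranks i r x"
        using monotone_onD[OF insert.prems(2), of x y] by (auto simp: raise_ranks_def)
    qed
    show "raise_ranks i r q = 0" if "q \<in> R" for q
      using that \<open>i \<in> K\<close> insert.prems(3)[of q] insert.prems(4)[of i q] by (simp add: raise_ranks_def)
  qed (use insert.prems in auto)
  moreover have "of_nat (card (completions l (insert p K) r R)) = completion_weight l (insert p K) r (card R)"
  proof (rule insert.IH)
    show "antimono_on (insert p K) r"
    proof (rule monotone_onI)
      fix x y assume "x \<in> insert p K" "y \<in> insert p K" "x \<le> y"
      then show "r y \<le> r x"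
        using monotone_onD[OF insert.prems(2), of x y] p insert.prems(4)[of y p] by auto
    qed
  qed (use insert.prems insert.hyps in auto)
  moreover have "of_nat (card (completions l K r R)) = completion_weight l K r (card R)"
    using insert.prems by (intro insert.IH) auto
  ultimately show ?case
    using insert.prems insert.hyps p by (simp add: card_completions_insert completion_weight_Suc)
qed

text \<open>
  In a descending subsequence of length \<open>2 l + 2\<close> either the first half consists of openers or the
  second half consists of closers, which gives \<open>l + 1\<close> nested cycles; conversely the openers and
  closers of nested cycles form a descending subsequence.
\<close>

lemma nests_bounded_iff:
  assumes \<tau>: "\<tau> permutes {1..n}" "\<tau> \<circ> \<tau> = id"
  shows "nests_bounded l (\<lambda>_. 0) \<tau> \<longleftrightarrow> \<not> has_descending_subseq n \<tau> (2 * l + 2)"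
proof -
  have inv: "\<tau> (\<tau> x) = x" for x
    using \<tau>(2) by (rule involution_apply)
  have "\<not> nests_bounded l (\<lambda>_. 0) \<tau>" if desc: "has_descending_subseq n \<tau> (2 * l + 2)"
  proof -
    obtain xs where len: "length xs = 2 * l + 2" and "set xs \<subseteq> {1..n}"
      and sorted: "sorted_wrt (<) xs" "sorted_wrt (>) (map \<tau> xs)"
      using desc unfolding has_descending_subseq_def by blast
    have less: "xs ! i < xs ! j" "\<tau> (xs ! j) < \<tau> (xs ! i)" if "i < j" "j < 2 * l + 2" for i j
      using sorted_wrt_nth_less[OF sorted(1) that(1)] sorted_wrt_nth_less[OF sorted(2) that(1)] that len
      by simp_all
    have inj: "inj_on ((!) xs) {..<2 * l + 2}"
      using less(1) unfolding inj_on_def by (metis lessThan_iff linorder_neqE_nat less_irrefl)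
    have "\<exists>A. nest \<tau> A \<and> card A = Suc l"
    proof (cases "xs ! l < \<tau> (xs ! l)")
      case True
      have "xs ! i < \<tau> (xs ! i)" if "i \<le> l" for i
        using less[of i l] True that by (cases "i = l") auto
      moreover have "\<tau> (xs ! j) < \<tau> (xs ! i)" if "i \<le> l" "j \<le> l" "xs ! i < xs ! j" for i j
        using that less[of i j] less[of j i] by (cases i j rule: linorder_cases) auto
      ultimately have "nest \<tau> ((!) xs ` {..l})"
        by (auto simp: nest_def)
      moreover have "card ((!) xs ` {..l}) = Suc l"
        by (subst card_image) (auto intro: inj_on_subset[OF inj])
      ultimately show ?thesis
        by blast
    next
      case False
      let ?f = "\<lambda>i. \<tau> (xs ! i)" and ?I = "{Suc l..<2 * l + 2}"
      have "?f i < xs ! i" if "i \<in> ?I" for i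
        using less[of l i] False that by auto
      moreover have "xs ! j < xs ! i" if "i \<in> ?I" "j \<in> ?I" "?f i < ?f j" for i j
        using that less[of i j] less[of j i] by (cases i j rule: linorder_cases) auto
      ultimately have "nest \<tau> (?f ` ?I)"
        by (auto simp: nest_def inv)
      moreover have "inj_on ?f ?I"
        using inj inv unfolding inj_on_def by (metis atLeastLessThan_iff lessThan_iff)
      then have "card (?f ` ?I) = Suc l"
        by (simp add: card_image)
      ultimately show ?thesis
        by blast
    qed
    then obtain A where A: "nest \<tau> A" "card A = Suc l"
      by blast
    then have "A \<noteq> {}"
      by auto
    with A show ?thesis
      by (auto simp: nests_bounded_def intro!: exI[of _ A])
  qed
  moreover have "has_descending_subseq n \<tau> (2 * l + 2)" if unbounded: "\<not> nests_bounded l (\<lambda>_. 0) \<tau>"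
  proof -
    obtain B where B: "nest \<tau> B" "Suc l \<le> card B"
      using unbounded by (auto simp: nests_bounded_def not_le Suc_le_eq)
    then obtain A where A: "A \<subseteq> B" "card A = Suc l"
      by (meson obtain_subset_with_card_n)
    then have nest: "nest \<tau> A"
      using B(1) by (auto simp: nest_def intro: finite_subset)
    define xs where "xs = sorted_list_of_set A"
    have xs: "set xs = A" "length xs = Suc l" "sorted_wrt (<) xs"
      using nest A by (auto simp: xs_def nest_def)
    have cross: "x < \<tau> y" if "x \<in> A" "y \<in> A" for x y
      using that nest by (cases x y rule: linorder_cases) (auto simp: nest_def intro: less_trans)
    have anti: "sorted_wrt (\<lambda>x y. \<tau> y < \<tau> x) xs"
      using xs(3) by (rule sorted_wrt_mono_rel[rotated]) (use nest xs(1) in \<open>auto simp: nest_def\<close>)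
    have "A \<subseteq> {1..n}"
      using \<tau>(1) nest by (rule nest_subset)
    then have "\<tau> ` A \<subseteq> {1..n}"
      using permutes_image[OF \<tau>(1)] by blast
    let ?ys = "xs @ rev (map \<tau> xs)"
    have "set ?ys \<subseteq> {1..n}"
      using xs \<open>A \<subseteq> {1..n}\<close> \<open>\<tau> ` A \<subseteq> {1..n}\<close> by simp
    moreover have "sorted_wrt (<) ?ys"
      using xs anti cross by (auto simp: sorted_wrt_append sorted_wrt_rev sorted_wrt_map)
    moreover have "map \<tau> ?ys = map \<tau> xs @ rev xs"
      by (simp add: rev_map inv o_def)
    moreover have "sorted_wrt (>) (map \<tau> xs @ rev xs)"
      using xs anti cross by (auto simp: sorted_wrt_append sorted_wrt_rev sorted_wrt_map)
    moreover have "length ?ys = 2 * l + 2"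
      using xs by simp
    ultimately show ?thesis
      unfolding has_descending_subseq_def by (intro exI[of _ ?ys] conjI) (simp_all only:)
  qed
  ultimately show ?thesis
    by blast
qed

lemma card_involutions_avoiding:
  "of_nat (card {a \<in> involutions_avoiding (2 * l + 1). fst a = n})
   = Poly_Mapping.lookup (det (ordinary_matrix l) * step_weight l ^ n) (staircase_exponent l)"
proof -
  have "{a \<in> involutions_avoiding (2 * l + 1). fst a = n} = Pair n ` completions l {} (\<lambda>_. 0) {1..n}"
    using nests_bounded_iff[of _ n l] by (auto simp: involutions_avoiding_def completions_def)
  then have "card {a \<in> involutions_avoiding (2 * l + 1). fst a = n} = card (completions l {} (\<lambda>_. 0) {1..n})"
    by (simp add: card_image inj_on_def)
  then show ?thesis
    using card_completions[of "{1..n}" "{}" "\<lambda>_. 0" l]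
    by (simp add: completion_weight_def monotone_on_def)
qed

section \<open>Both generating functions\<close>

lemma fps_geometric_nth: "fps_nth (fps_geometric a) n = a ^ n"
proof -
  let ?G = "Abs_fps (\<lambda>n. a ^ n)"
  have "?G * (1 - fps_X * fps_const a) = ?G - ?G * fps_const a * fps_X"
    by (simp add: algebra_simps)
  also have "\<dots> = 1"
    by (rule fps_ext) (simp add: power_eq_if mult.commute)
  finally have inverse: "?G * (1 - fps_X * fps_const a) = 1" .
  have "fps_geometric a = ?G * (1 - fps_X * fps_const a) * fps_geometric a"
    by (simp only: inverse mult_1_left)
  also have "\<dots> = ?G"
    by (simp only: mult.assoc fps_geometric_inverse mult_1_right)
  finally show ?thesis
    by (simp only: fps_nth_Abs_fps)
qed

lemma lookup_lconst_mult: "Poly_Mapping.lookup (lconst c * f) e = c * Poly_Mapping.lookup f e"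
  by (simp add: lconst_def lookup_single_mult)

lemma lookup_mult_lconst_mult:
  "Poly_Mapping.lookup (f * (lconst c * g)) e = c * Poly_Mapping.lookup (f * g) e"
  unfolding mult.left_commute[of f "lconst c"] by (rule lookup_lconst_mult)

lemma lconst_mult: "lconst a * lconst b = lconst (a * b)"
  by (simp add: lconst_def mult_single)

lemma lconst_of_nat: "lconst (of_nat n) = of_nat n"
  by (simp add: lconst_def)

lemma fps_exp_laurent_add: "fps_exp_laurent (a + b) = fps_exp_laurent a * fps_exp_laurent b"
proof (rule fps_ext)
  fix n
  have eq: "lconst (1 / fact n) * (of_nat (n choose k) * a ^ k * b ^ (n - k))
      = lconst (1 / fact k) * a ^ k * (lconst (1 / fact (n - k)) * b ^ (n - k))" if "k \<le> n" for k
  proof -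
    have "lconst (1 / fact n) * of_nat (n choose k) = lconst (1 / fact k) * lconst (1 / fact (n - k))"
      using that by (simp add: lconst_mult binomial_fact flip: lconst_of_nat)
    then show ?thesis
      by (metis (no_types) mult.assoc mult.left_commute)
  qed
  show "fps_nth (fps_exp_laurent (a + b)) n = fps_nth (fps_exp_laurent a * fps_exp_laurent b) n"
    by (simp add: fps_exp_laurent_def fps_mult_nth binomial_ring sum_distrib_left atLeast0AtMost)
       (intro sum.cong refl eq, simp)
qed

lemma fps_exp_laurent_0: "fps_exp_laurent 0 = 1"
  by (rule fps_ext) (simp add: fps_exp_laurent_def power_0_left lconst_def single_one)

lemma fps_exp_laurent_sum: "fps_exp_laurent (\<Sum>i\<in>I. f i) = (\<Prod>i\<in>I. fps_exp_laurent (f i))"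
  by (induction I rule: infinite_finite_induct) (simp_all add: fps_exp_laurent_0 fps_exp_laurent_add)

lemma det_exponential_matrix:
  "det (exponential_matrix l)
   = fps_const (det (ordinary_matrix l)) * fps_exp_laurent (\<Sum>j = 1..l. lvar j + lvar_inv j)"
proof -
  interpret c: comm_ring_hom "fps_const :: laurent \<Rightarrow> laurent fps"
    by unfold_locales simp_all
  let ?A = "\<lambda>i j. lvar (j + 1) ^ (i + 1) - lvar_inv (j + 1) ^ (i + 1)"
  let ?E = "\<lambda>j. fps_exp_laurent (lvar (j + 1) + lvar_inv (j + 1))"
  have "exponential_matrix l = mat l l (\<lambda>(i, j). ?E j * fps_const (?A i j))"
    by (intro eq_matI) (simp_all add: exponential_matrix_def mult.commute)
  moreover have "mat l l (\<lambda>(i, j). fps_const (?A i j)) = map_mat fps_const (ordinary_matrix l)"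
    by (intro eq_matI) (simp_all add: ordinary_matrix_def)
  moreover have "(\<Prod>j<l. ?E j) = (\<Prod>j = 1..l. fps_exp_laurent (lvar j + lvar_inv j))"
    by (rule prod.reindex_bij_witness[of _ "\<lambda>j. j - 1" Suc]) auto
  ultimately show ?thesis
    by (simp add: det_scale_cols fps_exp_laurent_sum mult.commute)
qed

lemma fps_exp_laurent_1_mult: 
  "extract_coeff e (fps_exp_laurent 1 * f) = fps_exp 1 * extract_coeff e f"
  by (rule fps_ext)
     (simp add: extract_coeff_def fps_mult_nth lookup_sum fps_exp_laurent_def lookup_lconst_mult)

theorem proposition9:
  fixes l m :: nat
  assumes "m = 2 * l + 1"
  shows "ordinary_gf fst (involutions_avoiding m) =
           extract_coeff (staircase_exponent l)
             (fps_const (det (ordinary_matrix l)) *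
              fps_geometric (1 + (\<Sum>j = 1..l. lvar j) + (\<Sum>j = 1..l. lvar_inv j))) \<and>
         exponential_gf fst (involutions_avoiding m) =
           fps_exp 1 * extract_coeff (staircase_exponent l) (det (exponential_matrix l))"
proof
  show "ordinary_gf fst (involutions_avoiding m) =
           extract_coeff (staircase_exponent l)
             (fps_const (det (ordinary_matrix l)) *
              fps_geometric (1 + (\<Sum>j = 1..l. lvar j) + (\<Sum>j = 1..l. lvar_inv j)))"
    unfolding step_weight_def[symmetric] assms
    by (rule fps_ext) (simp add: ordinary_gf_def extract_coeff_def fps_geometric_nth
        card_involutions_avoiding[simplified])
  have "fps_exp 1 * extract_coeff (staircase_exponent l) (det (exponential_matrix l))
      = extract_coeff (staircase_exponent l)
          (fps_const (det (ordinary_matrix l)) * fps_exp_laurent (step_weight l))"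
    unfolding det_exponential_matrix fps_exp_laurent_1_mult[symmetric]
    by (simp add: step_weight_def sum.distrib add.assoc fps_exp_laurent_add mult.left_commute)
  also have "\<dots> = exponential_gf fst (involutions_avoiding m)"
    unfolding assms
    by (rule fps_ext) (simp add: exponential_gf_def extract_coeff_def fps_exp_laurent_def
        lookup_mult_lconst_mult card_involutions_avoiding[simplified])
  finally show "exponential_gf fst (involutions_avoiding m) =
           fps_exp 1 * extract_coeff (staircase_exponent l) (det (exponential_matrix l))"
    by simp
qed

end
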